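(* The set of vertices of any parallelogram in $\mathbb{R}^2$ has the discrete Pompeiu property with respect to the rigid motions of the plane.
   Context: Let $\mathcal{G}$ be a family of bijections of a set $X$ onto itself. A nonempty finite set $K\subset X$ has the discrete Pompeiu property with respect to $\mathcal{G}$ if the following holds: whenever $f\colon X\to\mathbb{C}$ is a function (no regularity assumed) such that $\sum_{x\in K}f(\phi(x))=0$ for every $\phi\in\mathcal{G}$, then $f\equiv 0$. A rigid motion of the plane is an orientation-preserving isometry of $\mathbb{R}^2$, i.e. a translation or a rotation. *)

theory Defs
  imports "HOL-Analysis.Analysis"
begin

text \<open>The ground set \<open>X\<close> is the type \<open>'a\<close>; \<open>G\<close> is meant to be a family of bijections of \<open>X\<close>.\<close>

definition discrete_pompeiu :: "('a \<Rightarrow> 'a) set \<Rightarrow> 'a set \<Rightarrow> bool" where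
  "discrete_pompeiu G K \<longleftrightarrow>
     finite K \<and> K \<noteq> {} \<and>
     (\<forall>f :: 'a \<Rightarrow> complex. (\<forall>\<phi>\<in>G. (\<Sum>x\<in>K. f (\<phi> x)) = 0) \<longrightarrow> (\<forall>x. f x = 0))"

text \<open>
  An isometry \<open>\<phi>\<close> of the plane is affine with linear part \<open>\<lambda>v. \<phi> v - \<phi> 0\<close>, and it preserves
  orientation iff this linear part has positive determinant.
\<close>

definition rigid_motions :: "(real^2 \<Rightarrow> real^2) set" where
  "rigid_motions =
     {\<phi>. (\<forall>x y. dist (\<phi> x) (\<phi> y) = dist x y) \<and> det (matrix (\<lambda>v. \<phi> v - \<phi> 0)) > 0}"

lemma rigid_motions_iff:
  "\<phi> \<in> rigid_motions \<longleftrightarrow> (\<exists>A b. rotation_matrix A \<and> \<phi> = (\<lambda>x. A *v x + b))"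
proof
  assume "\<phi> \<in> rigid_motions"
  then have iso: "\<And>x y. dist (\<phi> x) (\<phi> y) = dist x y"
    and pos: "det (matrix (\<lambda>v. \<phi> v - \<phi> 0)) > 0"
    by (auto simp: rigid_motions_def)
  let ?L = "\<lambda>v. \<phi> v - \<phi> 0"
  have "orthogonal_transformation ?L"
    unfolding orthogonal_transformation_isometry using iso by (simp add: dist_norm)
  then have lin: "linear ?L" and orth: "orthogonal_matrix (matrix ?L)"
    by (auto simp: orthogonal_transformation_matrix)
  have "rotation_matrix (matrix ?L)"
    using orth pos det_orthogonal_matrix[OF orth] by (auto simp: rotation_matrix_def)
  moreover have "\<phi> = (\<lambda>x. matrix ?L *v x + \<phi> 0)"
    using lin by (simp add: matrix_works linear_matrix_vector_mul_eq)
  ultimately show "\<exists>A b. rotation_matrix A \<and> \<phi> = (\<lambda>x. A *v x + b)" by blast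
next
  assume "\<exists>A b. rotation_matrix A \<and> \<phi> = (\<lambda>x. A *v x + b)"
  then obtain A b where A: "orthogonal_matrix A" "det A = 1" and \<phi>: "\<phi> = (\<lambda>x. A *v x + b)"
    by (auto simp: rotation_matrix_def)
  have "orthogonal_transformation ((*v) A)"
    using A by (simp add: orthogonal_transformation_matrix)
  then have "dist (A *v x) (A *v y) = dist x y" for x y
    by (simp add: orthogonal_transformation_isometry)
  then show "\<phi> \<in> rigid_motions"
    using A by (simp add: rigid_motions_def \<phi>)
qed

lemma bij_rigid_motions:
  assumes "\<phi> \<in> rigid_motions"
  shows "bij \<phi>"
proof -
  obtain A b where A: "rotation_matrix A" and \<phi>: "\<phi> = (\<lambda>x. A *v x + b)"
    using assms by (auto simp: rigid_motions_iff)
  have "bij ((*v) A)"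
    using A by (intro orthogonal_transformation_bij)
      (simp add: orthogonal_transformation_matrix rotation_matrix_def)
  then have "bij ((\<lambda>y. y + b) \<circ> (*v) A)"
    by (intro bij_comp) (auto intro: bij_plus_right)
  then show ?thesis by (simp add: \<phi> o_def)
qed

text \<open>\<open>a\<close>, \<open>b\<close>, \<open>c\<close>, \<open>d\<close> are the vertices of a nondegenerate parallelogram in cyclic order.\<close>

definition parallelogram :: "real^2 \<Rightarrow> real^2 \<Rightarrow> real^2 \<Rightarrow> real^2 \<Rightarrow> bool" where
  "parallelogram a b c d \<longleftrightarrow> \<not> collinear {a, b, d} \<and> b - a = c - d"

end

theory Submission
  imports Defs
begin

text \<open>
  Let \<open>u\<close> and \<open>v\<close> span the parallelogram, and for a vector \<open>w\<close> let \<open>S\<^sub>w\<close> be the operator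
  \<open>1 + (translation by w)\<close> on functions. The sum of the translates of \<open>f\<close> over the four vertices
  factors, so the hypothesis on \<open>f\<close> says that \<open>S\<^bsub>Ru\<^esub> (S\<^bsub>Rv\<^esub> f) = 0\<close> for every rotation \<open>R\<close>.
  All these operators commute. Hence, given finitely many rotations, a nonzero \<open>f\<close> can be replaced
  by a nonzero \<open>g\<close> that, for each of the rotations, is annihilated by one of the two factors
  (\<open>peel_factors\<close>): it changes sign under translation by \<open>Ru\<close> or under translation by \<open>Rv\<close>.

  The choice of the annihilating factor is a 2-colouring of the chosen rotations. Take the rotations
  by \<open>0, \<theta>, \<dots>, 8\<theta>\<close>. A 2-colouring of \<open>{0, \<dots>, 8}\<close> has a monochromatic progression
  \<open>i, i + j, i + 2j\<close> (\<open>monochromatic_progression\<close>), and the three rotates of any vector \<open>w\<close> by these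
  multiples of \<open>\<theta>\<close> satisfy \<open>R\<^sub>i w + R\<^bsub>i+2j\<^esub> w = 2 cos (j\<theta>) R\<^bsub>i+j\<^esub> w\<close>. The angle is chosen with
  \<open>cos \<theta> = 3/4\<close>, because then \<open>2\<^sup>j \<sqdot> 2 cos (j\<theta>)\<close> is an odd integer \<open>c\<close> for all \<open>j \<ge> 1\<close>
  (\<open>odd_multiple_cos\<close>). Translating by \<open>2\<^sup>j\<close> times the two outer vectors does not change \<open>g\<close>, while
  translating by \<open>c\<close> times the middle one changes its sign; both are the same translation, so
  \<open>g = -g\<close>, which contradicts \<open>g \<noteq> 0\<close>.
\<close>

definition shift_sum :: "'v::ab_group_add \<Rightarrow> ('v \<Rightarrow> complex) \<Rightarrow> 'v \<Rightarrow> complex" where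
  "shift_sum w g = (\<lambda>x. g x + g (x + w))"

lemma shift_sum_commute: "shift_sum w (shift_sum w' g) = shift_sum w' (shift_sum w g)"
  by (simp add: shift_sum_def fun_eq_iff algebra_simps)

lemma shift_sum_zero [simp]: "shift_sum w (\<lambda>x. 0) = (\<lambda>x. 0)"
  by (simp add: shift_sum_def)

text \<open>
  If \<open>shift_sum (v n) g\<close> is nonzero, it can serve as the new \<open>g\<close>, since it is annihilated by the
  other factor; otherwise \<open>g\<close> itself is annihilated. By commutativity, annihilation that was achieved
  earlier is kept.
\<close>

lemma peel_factors:
  fixes u v :: "nat \<Rightarrow> 'v::ab_group_add"
  assumes "f \<noteq> (\<lambda>x. 0)" and "\<And>k. shift_sum (u k) (shift_sum (v k) f) = (\<lambda>x. 0)"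
  shows "\<exists>g. g \<noteq> (\<lambda>x. 0) \<and> (\<forall>k. shift_sum (u k) (shift_sum (v k) g) = (\<lambda>x. 0)) \<and>
    (\<forall>k<n. shift_sum (u k) g = (\<lambda>x. 0) \<or> shift_sum (v k) g = (\<lambda>x. 0))"
proof (induction n)
  case 0
  then show ?case using assms by blast
next
  case (Suc n)
  then obtain g where g: "g \<noteq> (\<lambda>x. 0)"
      "\<And>k. shift_sum (u k) (shift_sum (v k) g) = (\<lambda>x. 0)"
      "\<And>k. k < n \<Longrightarrow> shift_sum (u k) g = (\<lambda>x. 0) \<or> shift_sum (v k) g = (\<lambda>x. 0)"
    by blast
  show ?case
  proof (cases "shift_sum (v n) g = (\<lambda>x. 0)")
    case True
    then show ?thesis using g less_Suc_eq by metis
  next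
    case False
    let ?h = "shift_sum (v n) g"
    have keep: "shift_sum w ?h = (\<lambda>x. 0)" if "shift_sum w g = (\<lambda>x. 0)" for w
      using that shift_sum_commute[of w "v n" g] by simp
    have "shift_sum (u k) (shift_sum (v k) ?h) = (\<lambda>x. 0)" for k
      using g(2)[of k] shift_sum_commute[of "v k" "v n" g]
        shift_sum_commute[of "u k" "v n" "shift_sum (v k) g"] by simp
    moreover have "shift_sum (u k) ?h = (\<lambda>x. 0) \<or> shift_sum (v k) ?h = (\<lambda>x. 0)"
      if "k < Suc n" for k
      using that g(2)[of n] g(3)[of k] keep less_Suc_eq by metis
    ultimately show ?thesis using False by blast
  qed
qed

lemma shift_sum_zero_multiple:
  fixes w :: "'v::real_vector"
  assumes "shift_sum w g = (\<lambda>x. 0)"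
  shows "g (x + of_int n *\<^sub>R w) = (if even n then g x else - g x)"
proof -
  have step: "g (y + w) = - g y" for y
    using assms by (auto simp: shift_sum_def fun_eq_iff eq_neg_iff_add_eq_0 add.commute)
  show ?thesis
  proof (induction n rule: int_induct[where k = 0])
    case base
    then show ?case by simp
  next
    case (step1 i)
    then show ?case using step[of "x + of_int i *\<^sub>R w"] by (auto simp: algebra_simps)
  next
    case (step2 i)
    then show ?case using step[of "x + of_int (i - 1) *\<^sub>R w"] by (auto simp: algebra_simps)
  qed
qed

text \<open>
  Both sides of the relation describe one translation: written with the outer vectors it consists of
  an even number of sign changes, written with the middle vector of an odd number.
\<close>

lemma odd_relation_imp_zero:
  fixes p q r :: "'v::real_vector" and m c :: int
  assumes "shift_sum p g = (\<lambda>x. 0)" "shift_sum q g = (\<lambda>x. 0)" "shift_sum r g = (\<lambda>x. 0)"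
    and "of_int m *\<^sub>R (p + r) = of_int c *\<^sub>R q" and "odd c"
  shows "g = (\<lambda>x. 0)"
proof
  fix x
  have "g (x + of_int m *\<^sub>R p + of_int m *\<^sub>R r) = g x"
    using assms(1,3) by (simp add: shift_sum_zero_multiple)
  moreover have "g (x + of_int c *\<^sub>R q) = - g x"
    using assms(2,5) by (simp add: shift_sum_zero_multiple)
  moreover have "x + of_int m *\<^sub>R p + of_int m *\<^sub>R r = x + of_int c *\<^sub>R q"
    using assms(4) by (simp add: algebra_simps)
  ultimately show "g x = 0" by simp
qed

text \<open>The bound is the van der Waerden number \<open>W(3, 2) = 9\<close>.\<close>

lemma monochromatic_progression:
  fixes P :: "nat \<Rightarrow> bool"
  shows "\<exists>i j. 0 < j \<and> i + 2 * j \<le> 8 \<and> P i = P (i + j) \<and> P (i + j) = P (i + 2 * j)"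
proof (rule ccontr)
  assume "\<not> ?thesis"
  then have no: "\<not> (P i = P (i + j) \<and> P (i + j) = P (i + 2 * j))" if "0 < j" "i + 2 * j \<le> 8" for i j
    using that by blast
  show False
    using no[of 1 0] no[of 1 1] no[of 1 2] no[of 1 3] no[of 1 4] no[of 1 5] no[of 1 6]
      no[of 2 0] no[of 2 1] no[of 2 2] no[of 2 3] no[of 2 4]
      no[of 3 0] no[of 3 1] no[of 3 2] no[of 4 0]
    by (simp add: numeral_eq_Suc) argo
qed

text \<open>
  With \<open>c\<^sub>j = 2\<^sup>j \<sqdot> 2 cos (j\<theta>)\<close> the Chebyshev recursion reads \<open>c\<^bsub>j+2\<^esub> = 3 c\<^bsub>j+1\<^esub> - 4 c\<^sub>j\<close>, which
  preserves the parity of \<open>c\<^sub>1 = 3\<close>.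
\<close>

lemma odd_multiple_cos:
  assumes "cos \<theta> = 3 / 4" and "0 < j"
  shows "\<exists>c::int. odd c \<and> 2 ^ j * (2 * cos (real j * \<theta>)) = of_int c"
proof -
  have rec: "cos (real (Suc (Suc n)) * \<theta>) = 3 / 2 * cos (real (Suc n) * \<theta>) - cos (real n * \<theta>)" for n
    using cos_add[of "real (Suc n) * \<theta>" \<theta>] cos_diff[of "real (Suc n) * \<theta>" \<theta>] assms(1)
    by (simp add: algebra_simps)
  have "\<exists>c d::int. odd c \<and> 2 ^ Suc n * (2 * cos (real (Suc n) * \<theta>)) = of_int c \<and>
      2 ^ n * (2 * cos (real n * \<theta>)) = of_int d" for n
  proof (induction n)
    case 0
    show ?case using assms(1) by (intro exI[of _ 3] exI[of _ 2]) simp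
  next
    case (Suc n)
    then obtain c d :: int where cd: "odd c" "2 ^ Suc n * (2 * cos (real (Suc n) * \<theta>)) = of_int c"
      "2 ^ n * (2 * cos (real n * \<theta>)) = of_int d" by blast
    have "2 ^ Suc (Suc n) * (2 * cos (real (Suc (Suc n)) * \<theta>)) =
        3 * (2 ^ Suc n * (2 * cos (real (Suc n) * \<theta>))) - 4 * (2 ^ n * (2 * cos (real n * \<theta>)))"
      unfolding rec by (simp add: field_simps)
    also have "\<dots> = of_int (3 * c - 4 * d)"
      unfolding cd by simp
    finally show ?case
      using cd(1,2) by (intro exI[of _ "3 * c - 4 * d"] exI[of _ c]) simp
  qed
  then show ?thesis
    using assms(2) gr0_conv_Suc by metis
qed

definition plane_rotation :: "real \<Rightarrow> real^2^2" where
  "plane_rotation t = vector [vector [cos t, - sin t], vector [sin t, cos t]]"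

lemma plane_rotation_mult_vec:
  "plane_rotation t *v x = vector [cos t * x$1 - sin t * x$2, sin t * x$1 + cos t * x$2]"
  by (simp add: plane_rotation_def vec_eq_iff forall_2 matrix_vector_mult_def sum_2)

lemma rotation_matrix_plane_rotation: "rotation_matrix (plane_rotation t)"
  by (simp add: rotation_matrix_def orthogonal_matrix_def plane_rotation_def vec_eq_iff forall_2
      matrix_matrix_mult_def sum_2 transpose_def mat_def det_2 power2_eq_square[symmetric])

lemma plane_rotation_add_symmetric:
  "plane_rotation (s - t) *v x + plane_rotation (s + t) *v x =
     (2 * cos t) *\<^sub>R (plane_rotation s *v x)"
  by (simp add: plane_rotation_mult_vec vec_eq_iff forall_2 sin_add sin_diff cos_add cos_diff
      algebra_simps)

theorem theorem5p1:
  fixes a b c d :: "real^2"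
  assumes "parallelogram a b c d"
  shows "discrete_pompeiu rigid_motions {a, b, c, d}"
proof -
  define u v where "u = b - a" and "v = d - a"
  have vertices: "b = a + u" "d = a + v" "c = a + u + v"
    using assms by (auto simp: parallelogram_def u_def v_def algebra_simps)
  have indep: "\<not> collinear {a, b, d}"
    using assms by (simp add: parallelogram_def)
  have distinct: "a \<noteq> b" "a \<noteq> d" "b \<noteq> d"
    using indep by (auto simp: insert_commute)
  have "u + v \<noteq> 0"
  proof
    assume "u + v = 0"
    then have "d - a = (- 1) *\<^sub>R (b - a)"
      by (simp add: u_def v_def algebra_simps eq_neg_iff_add_eq_0)
    then have "collinear {0, b - a, d - a}"
      unfolding collinear_lemma by blast
    then have "collinear {b, a, d}"
      by (subst collinear_3) auto
    then show False using indep by (simp add: insert_commute)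
  qed
  then have "a \<noteq> c" "b \<noteq> c" "c \<noteq> d"
    using distinct by (auto simp: vertices add.assoc)
  have "f x = 0"
    if f: "\<And>\<phi>. \<phi> \<in> rigid_motions \<Longrightarrow> (\<Sum>x\<in>{a, b, c, d}. f (\<phi> x)) = 0"
    for f :: "real^2 \<Rightarrow> complex" and x
  proof (rule ccontr)
    assume "f x \<noteq> 0"
    then have nz: "f \<noteq> (\<lambda>x. 0)" by auto
    define \<theta> :: real where "\<theta> = arccos (3 / 4)"
    have \<theta>: "cos \<theta> = 3 / 4" by (simp add: \<theta>_def)
    define R where "R k = plane_rotation (real k * \<theta>)" for k :: nat
    have factors: "shift_sum (R k *v u) (shift_sum (R k *v v) f) = (\<lambda>x. 0)" for k
    proof
      fix y
      have "(\<lambda>z. R k *v z + (y - R k *v a)) \<in> rigid_motions"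
        unfolding rigid_motions_iff R_def using rotation_matrix_plane_rotation by blast
      from f[OF this] show "shift_sum (R k *v u) (shift_sum (R k *v v) f) y = 0"
        using distinct \<open>a \<noteq> c\<close> \<open>b \<noteq> c\<close> \<open>c \<noteq> d\<close>
        by (simp add: shift_sum_def)
          (simp add: vertices matrix_vector_right_distrib algebra_simps)
    qed
    obtain g where g: "g \<noteq> (\<lambda>x. 0)"
      "\<And>k. k < 9 \<Longrightarrow> shift_sum (R k *v u) g = (\<lambda>x. 0) \<or> shift_sum (R k *v v) g = (\<lambda>x. 0)"
      using peel_factors[of f "\<lambda>k. R k *v u" "\<lambda>k. R k *v v" 9, OF nz factors] by blast
    obtain i j where ij: "0 < j" "i + 2 * j \<le> 8"
      "(shift_sum (R i *v u) g = (\<lambda>x. 0)) = (shift_sum (R (i + j) *v u) g = (\<lambda>x. 0))"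
      "(shift_sum (R (i + j) *v u) g = (\<lambda>x. 0)) = (shift_sum (R (i + 2 * j) *v u) g = (\<lambda>x. 0))"
      using monochromatic_progression[of "\<lambda>k. shift_sum (R k *v u) g = (\<lambda>x. 0)"] by blast
    have "i < 9" "i + j < 9" "i + 2 * j < 9" using ij by auto
    then obtain w where w: "shift_sum (R i *v w) g = (\<lambda>x. 0)"
      "shift_sum (R (i + j) *v w) g = (\<lambda>x. 0)" "shift_sum (R (i + 2 * j) *v w) g = (\<lambda>x. 0)"
      using ij g(2) by metis
    obtain e :: int where e: "odd e" "2 ^ j * (2 * cos (real j * \<theta>)) = of_int e"
      using odd_multiple_cos[OF \<theta> ij(1)] by blast
    have "R i *v w + R (i + 2 * j) *v w = (2 * cos (real j * \<theta>)) *\<^sub>R (R (i + j) *v w)"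
      using plane_rotation_add_symmetric[of "real (i + j) * \<theta>" "real j * \<theta>" w]
      by (simp add: R_def algebra_simps)
    then have "of_int (2 ^ j) *\<^sub>R (R i *v w + R (i + 2 * j) *v w) = of_int e *\<^sub>R (R (i + j) *v w)"
      using e(2) by simp
    then have "g = (\<lambda>x. 0)"
      using odd_relation_imp_zero[OF w] e(1) by blast
    then show False using g(1) by simp
  qed
  then show ?thesis
    by (auto simp: discrete_pompeiu_def)
qed

end
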